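(* Let $\mathscr{F}$ be a non-empty class of graphs. For every two graphs $G$ and $H$ in $\mathscr{F}$, the following statements are equivalent: (1) $G$ and $H$ are isomorphic. (2) $\hom(\mathrm{Ext}(\mathscr{F}),G)=\hom(\mathrm{Ext}(\mathscr{F}),H)$. (3) $\hom(G,\mathrm{Ext}(\mathscr{F}))=\hom(H,\mathrm{Ext}(\mathscr{F}))$. In particular, if $\mathrm{Ext}(\mathscr{F})=\mathscr{F}$, then for every two graphs $G$ and $H$ in $\mathscr{F}$, we have that $G$ and $H$ are isomorphic if and only if their left profiles restricted to $\mathscr{F}$ are equal (i.e., $\hom(\mathscr{F},G)=\hom(\mathscr{F},H)$), and if and only if their right profiles restricted to $\mathscr{F}$ are equal (i.e., $\hom(G,\mathscr{F})=\hom(H,\mathscr{F})$).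
   Context: All graphs are finite, undirected and simple (no self-loops, no multi-edges). A class of graphs means a non-empty collection of graphs closed under isomorphism. A homomorphism $h:G\to H$ is a map $h:V(G)\to V(H)$ such that $(u,v)\in E(G)$ implies $(h(u),h(v))\in E(H)$; $\hom(G,H)$ denotes the number of homomorphisms from $G$ to $H$. For a class $\mathscr{A}$ of graphs, the left and right profiles of $G$ restricted to $\mathscr{A}$ are $\hom(\mathscr{A},G)=(\hom(F,G)\mid F\in\mathscr{A})$ and $\hom(G,\mathscr{A})=(\hom(G,F)\mid F\in\mathscr{A})$; equality of profiles means equality entry by entry. A homomorphism $h:G\to H$ is injective if the map $V(G)\to V(H)$ is injective. It is surjective if the image $h(G)$ coincides with $H$ on both vertices and edges, i.e., $V(h(G))=V(H)$ and $E(h(G))=E(H)$. For a class $\mathscr{F}$ of graphs: $\mathrm{Inj}(\mathscr{F})$ is the class of all graphs $G$ such that there is an injective homomorphism $h:G\to F$ to some $F\in\mathscr{F}$; $\mathrm{Sur}(\mathscr{F})$ is the class of all graphs $G$ such that there is a surjective homomorphism $h:F\to G$ from some $F\in\mathscr{F}$ onto $G$; and the extension class of $\mathscr{F}$ is $\mathrm{Ext}(\mathscr{F})=\mathrm{Sur}(\mathscr{F})\cap\mathrm{Inj}(\mathscr{F})$. *)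

theory Defs
  imports
    "Graph_Theory.Pair_Digraph"
    "Graph_Theory.Digraph_Isomorphism"
    "HOL-Library.FuncSet"
begin

text \<open>
  A finite simple undirected graph is a record \<open>G :: 'a pair_pre_digraph\<close> with \<open>pair_graph G\<close>:
  finite vertex set, and a symmetric, irreflexive set of arcs, so that an edge \<open>{u, v}\<close> is
  represented by both \<open>(u, v)\<close> and \<open>(v, u)\<close>.  The graph without vertices is allowed.
  A class of graphs consists of graphs with vertices in a common type \<open>'a\<close>;
  for an infinite \<open>'a\<close> (say \<open>nat\<close>) every finite graph has an isomorphic copy on \<open>'a\<close>.
\<close>

definition graph_iso :: "'a pair_pre_digraph \<Rightarrow> 'b pair_pre_digraph \<Rightarrow> bool" where
  "graph_iso G H \<longleftrightarrow> digraph_iso (with_proj G) (with_proj H)"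

definition graph_class :: "'a pair_pre_digraph set \<Rightarrow> bool" where
  "graph_class \<F> \<longleftrightarrow> \<F> \<noteq> {} \<and> (\<forall>G\<in>\<F>. pair_graph G) \<and>
     (\<forall>G\<in>\<F>. \<forall>H. pair_graph H \<longrightarrow> graph_iso G H \<longrightarrow> H \<in> \<F>)"

text \<open>
  Maps are extensional (\<open>undefined\<close> outside \<open>pverts G\<close>), so that distinct elements of
  \<open>homs G H\<close> differ on \<open>pverts G\<close> and \<open>card\<close> counts each homomorphism once.
\<close>

definition homs :: "'a pair_pre_digraph \<Rightarrow> 'b pair_pre_digraph \<Rightarrow> ('a \<Rightarrow> 'b) set" where
  "homs G H = {h \<in> pverts G \<rightarrow>\<^sub>E pverts H. \<forall>u v. (u, v) \<in> parcs G \<longrightarrow> (h u, h v) \<in> parcs H}"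

definition hom_count :: "'a pair_pre_digraph \<Rightarrow> 'b pair_pre_digraph \<Rightarrow> nat" where
  "hom_count G H = card (homs G H)"

definition inj_hom :: "('a \<Rightarrow> 'b) \<Rightarrow> 'a pair_pre_digraph \<Rightarrow> 'b pair_pre_digraph \<Rightarrow> bool" where
  "inj_hom h G H \<longleftrightarrow> h \<in> homs G H \<and> inj_on h (pverts G)"

definition surj_hom :: "('a \<Rightarrow> 'b) \<Rightarrow> 'a pair_pre_digraph \<Rightarrow> 'b pair_pre_digraph \<Rightarrow> bool" where
  "surj_hom h G H \<longleftrightarrow>
     h \<in> homs G H \<and> h ` pverts G = pverts H \<and> map_prod h h ` parcs G = parcs H"

definition Inj_class :: "'a pair_pre_digraph set \<Rightarrow> 'a pair_pre_digraph set" where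
  "Inj_class \<F> = {G. pair_graph G \<and> (\<exists>F\<in>\<F>. \<exists>h. inj_hom h G F)}"

definition Sur_class :: "'a pair_pre_digraph set \<Rightarrow> 'a pair_pre_digraph set" where
  "Sur_class \<F> = {G. pair_graph G \<and> (\<exists>F\<in>\<F>. \<exists>h. surj_hom h F G)}"

definition Ext_class :: "'a pair_pre_digraph set \<Rightarrow> 'a pair_pre_digraph set" where
  "Ext_class \<F> = Sur_class \<F> \<inter> Inj_class \<F>"

text \<open>
  Profiles are families indexed by the members of the class; equality of two families
  restricted to \<open>\<A>\<close> is entrywise equality on \<open>\<A>\<close>.
\<close>

definition left_profile ::
    "'a pair_pre_digraph set \<Rightarrow> 'b pair_pre_digraph \<Rightarrow> 'a pair_pre_digraph \<Rightarrow> nat" where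
  "left_profile \<A> G = (\<lambda>F\<in>\<A>. hom_count F G)"

definition right_profile ::
    "'b pair_pre_digraph \<Rightarrow> 'a pair_pre_digraph set \<Rightarrow> 'a pair_pre_digraph \<Rightarrow> nat" where
  "right_profile G \<A> = (\<lambda>F\<in>\<A>. hom_count G F)"

text \<open>\<open>digraph_iso\<close> specialises to the usual isomorphism of simple graphs.\<close>

lemma graph_iso_iff:
  assumes "pair_graph G" "pair_graph H"
  shows "graph_iso G H \<longleftrightarrow>
    (\<exists>f. bij_betw f (pverts G) (pverts H) \<and>
      (\<forall>u\<in>pverts G. \<forall>v\<in>pverts G. (u, v) \<in> parcs G \<longleftrightarrow> (f u, f v) \<in> parcs H))"
proof
  interpret G: pair_graph G by fact
  interpret H: pair_graph H by fact
  assume "graph_iso G H"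
  then obtain i where i: "pre_digraph.digraph_isomorphism (with_proj G) i"
    and H: "with_proj H = app_iso i (with_proj G)"
    by (auto simp: graph_iso_def digraph_iso_def)
  let ?f = "iso_verts i"
  have inj: "inj_on ?f (pverts G)"
    and ends: "\<And>a. a \<in> parcs G \<Longrightarrow> ?f (fst a) = iso_tail i (iso_arcs i a)
                 \<and> ?f (snd a) = iso_head i (iso_arcs i a)"
    using i by (auto simp: pre_digraph.digraph_isomorphism_def)
  have V: "pverts H = ?f ` pverts G" and A: "parcs H = iso_arcs i ` parcs G"
    and T: "iso_tail i = fst" and Hd: "iso_head i = snd"
    using H by (simp_all add: with_proj_def app_iso_def)
  have arc: "iso_arcs i (u, v) = (?f u, ?f v)" if "(u, v) \<in> parcs G" for u v
    using ends[OF that] by (simp add: T Hd prod_eq_iff)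
  have "(u, v) \<in> parcs G \<longleftrightarrow> (?f u, ?f v) \<in> parcs H" if "u \<in> pverts G" "v \<in> pverts G" for u v
  proof
    assume "(u, v) \<in> parcs G"
    then show "(?f u, ?f v) \<in> parcs H" using arc A by (metis image_eqI)
  next
    assume "(?f u, ?f v) \<in> parcs H"
    then obtain x y where xy: "(x, y) \<in> parcs G" "iso_arcs i (x, y) = (?f u, ?f v)"
      using A by auto
    then have "?f x = ?f u" "?f y = ?f v" using arc by auto
    then show "(u, v) \<in> parcs G"
      using xy(1) that inj G.in_arcsD1 G.in_arcsD2 by (metis inj_onD)
  qed
  then show "\<exists>f. bij_betw f (pverts G) (pverts H) \<and>
      (\<forall>u\<in>pverts G. \<forall>v\<in>pverts G. (u, v) \<in> parcs G \<longleftrightarrow> (f u, f v) \<in> parcs H)"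
    using inj V by (auto simp: bij_betw_def)
next
  interpret G: pair_graph G by fact
  interpret H: pair_graph H by fact
  assume "\<exists>f. bij_betw f (pverts G) (pverts H) \<and>
      (\<forall>u\<in>pverts G. \<forall>v\<in>pverts G. (u, v) \<in> parcs G \<longleftrightarrow> (f u, f v) \<in> parcs H)"
  then obtain f where f: "inj_on f (pverts G)" "f ` pverts G = pverts H"
    and e: "\<And>u v. u \<in> pverts G \<Longrightarrow> v \<in> pverts G \<Longrightarrow> (u, v) \<in> parcs G \<longleftrightarrow> (f u, f v) \<in> parcs H"
    by (auto simp: bij_betw_def)
  let ?i = "\<lparr>iso_verts = f, iso_arcs = map_prod f f, iso_head = snd, iso_tail = fst\<rparr>"
  have sub: "parcs G \<subseteq> pverts G \<times> pverts G" "parcs H \<subseteq> pverts H \<times> pverts H"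
    using G.in_arcsD1 G.in_arcsD2 H.in_arcsD1 H.in_arcsD2 by auto
  have "inj_on (map_prod f f) (parcs G)"
    using map_prod_inj_on[OF f(1) f(1)] sub(1) by (rule inj_on_subset)
  then have "pre_digraph.digraph_isomorphism (with_proj G) ?i"
    using f(1) G.wf_digraph by (auto simp: pre_digraph.digraph_isomorphism_def)
  moreover have "map_prod f f ` parcs G = parcs H"
  proof (intro equalityI subsetI)
    fix a assume "a \<in> map_prod f f ` parcs G"
    then show "a \<in> parcs H" using e sub(1) by auto
  next
    fix a assume a: "a \<in> parcs H"
    obtain x y where xy: "a = (x, y)" by (cases a)
    with a sub(2) f(2) obtain u v where "u \<in> pverts G" "v \<in> pverts G" "x = f u" "y = f v"
      by blast
    then show "a \<in> map_prod f f ` parcs G"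
      using e a xy by (auto intro!: image_eqI[of _ _ "(u, v)"])
  qed
  then have "with_proj H = app_iso ?i (with_proj G)"
    using f(2) by (simp add: with_proj_def app_iso_def)
  ultimately show "graph_iso G H"
    unfolding graph_iso_def digraph_iso_def by blast
qed

end

theory Submission
  imports Defs
begin

text \<open>
  The argument is that of Lovasz. Every homomorphism \<open>A \<rightarrow> G\<close> is a quotient map of \<open>A\<close> followed by
  an injective homomorphism, so the number of homomorphisms \<open>A \<rightarrow> G\<close> is the sum, over the kernels
  on \<open>A\<close>, of the numbers of injective homomorphisms from the quotients into \<open>G\<close>
  (\<open>card_homs_with_kernel\<close>). The trivial kernel contributes the injective homomorphisms
  \<open>A \<rightarrow> G\<close>, every other kernel a quotient with fewer vertices. By induction on the number of
  vertices, two graphs with the same left profile receive equally many injective homomorphisms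
  from each test graph (\<open>inj_hom_count_eq\<close>). With \<open>G\<close> and \<open>H\<close> themselves as test graphs, each
  embeds into the other, and finiteness makes them isomorphic.

  The right-hand side is dual: a homomorphism \<open>G \<rightarrow> A\<close> is a surjective one onto its
  image, a subgraph of \<open>A\<close>, and the image is either \<open>A\<close> or a smaller graph. Hence equal right
  profiles give equally many surjective homomorphisms onto each test graph
  (\<open>surj_hom_count_eq\<close>).

  Both inductions need equal counts for the smaller graphs too, and the extension class
  provides exactly that (\<open>hom_image_in_Ext_class\<close>). A quotient of a test graph \<open>A\<close> is again a
  surjective image of a member of \<open>\<F>\<close>, and if it contributes at all it embeds into \<open>G\<close> or \<open>H\<close>.
  An image of \<open>G\<close> or \<open>H\<close> inside \<open>A\<close> is a surjective image of a member of \<open>\<F>\<close> and embeds,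
  through \<open>A\<close>, into a member of \<open>\<F>\<close>.
\<close>

section \<open>Images and composition of homomorphisms\<close>

definition hom_image :: "('a \<Rightarrow> 'b) \<Rightarrow> 'a pair_pre_digraph \<Rightarrow> 'b pair_pre_digraph" where
  "hom_image h G = \<lparr>pverts = h ` pverts G, parcs = map_prod h h ` parcs G\<rparr>"

lemma pverts_hom_image [simp]: "pverts (hom_image h G) = h ` pverts G"
  and parcs_hom_image [simp]: "parcs (hom_image h G) = map_prod h h ` parcs G"
  by (simp_all add: hom_image_def)

lemma surj_hom_iff_hom_image: "surj_hom h G B \<longleftrightarrow> h \<in> homs G B \<and> hom_image h G = B"
  by (auto simp: surj_hom_def hom_image_def)

lemma pair_graph_arcs_subset:
  assumes "pair_graph G"
  shows "parcs G \<subseteq> pverts G \<times> pverts G"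
proof -
  interpret pair_graph G by fact
  show ?thesis using in_arcsD1 in_arcsD2 by auto
qed

lemma finite_pverts:
  assumes "pair_graph G"
  shows "finite (pverts G)"
proof -
  interpret pair_graph G by fact
  show ?thesis by simp
qed

lemma finite_parcs:
  assumes "pair_graph G"
  shows "finite (parcs G)"
proof -
  interpret pair_graph G by fact
  show ?thesis by simp
qed

lemma finite_homs:
  assumes "pair_graph G" "pair_graph H"
  shows "finite (homs G H)"
  by (rule finite_subset[of _ "pverts G \<rightarrow>\<^sub>E pverts H"])
    (auto simp: homs_def intro!: finite_PiE finite_pverts assms)

lemma homs_comp:
  assumes "pair_graph A" "f \<in> homs A B" "g \<in> homs B C"
  shows "(\<lambda>v\<in>pverts A. g (f v)) \<in> homs A C"
  using assms(2,3) pair_graph_arcs_subset[OF assms(1)] unfolding homs_def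
  by (auto simp: PiE_iff)

lemma id_homs:
  assumes "pair_graph A"
  shows "(\<lambda>v\<in>pverts A. v) \<in> homs A A"
  using pair_graph_arcs_subset[OF assms] unfolding homs_def by auto

lemma inj_hom_id:
  assumes "pair_graph A"
  shows "inj_hom (\<lambda>v\<in>pverts A. v) A A"
  using id_homs[OF assms] by (auto simp: inj_hom_def inj_on_def)

lemma surj_hom_id:
  assumes "pair_graph A"
  shows "surj_hom (\<lambda>v\<in>pverts A. v) A A"
proof -
  have "map_prod (\<lambda>v\<in>pverts A. v) (\<lambda>v\<in>pverts A. v) ` parcs A = id ` parcs A"
    using pair_graph_arcs_subset[OF assms] by (intro image_cong) auto
  then show ?thesis using id_homs[OF assms] by (simp add: surj_hom_def)
qed

lemma inj_hom_comp:
  assumes "pair_graph A" "inj_hom f A B" "inj_hom g B C"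
  shows "inj_hom (\<lambda>v\<in>pverts A. g (f v)) A C"
proof -
  have "f v \<in> pverts B" if "v \<in> pverts A" for v
    using assms(2) that by (auto simp: inj_hom_def homs_def)
  then show ?thesis
    using assms(2,3) homs_comp[OF assms(1), of f B g C] by (simp add: inj_hom_def inj_on_def)
qed

lemma surj_hom_to_hom_image:
  assumes "pair_graph A" "surj_hom h A B"
  shows "surj_hom (\<lambda>v\<in>pverts A. r (h v)) A (hom_image r B)"
proof -
  let ?f = "\<lambda>v\<in>pverts A. r (h v)"
  have V: "pverts B = h ` pverts A" and E: "parcs B = map_prod h h ` parcs A"
    using assms(2) by (auto simp: surj_hom_def)
  have "map_prod ?f ?f ` parcs A = map_prod r r ` parcs B"
    unfolding E image_image using pair_graph_arcs_subset[OF assms(1)]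
    by (intro image_cong) auto
  moreover have "?f \<in> homs A (hom_image r B)"
  proof -
    have "(?f u, ?f v) \<in> parcs (hom_image r B)" if "(u, v) \<in> parcs A" for u v
    proof -
      have "map_prod ?f ?f (u, v) \<in> map_prod ?f ?f ` parcs A" using that by (rule imageI)
      then show ?thesis using calculation by simp
    qed
    then show ?thesis by (auto simp: homs_def V)
  qed
  ultimately show ?thesis by (simp add: surj_hom_def V image_image)
qed

text \<open>
  A quotient of a simple graph may acquire loops. One that still maps to a simple graph has
  none, and these are the only quotients that ever contribute to a homomorphism count.
\<close>

lemma pair_graph_hom_image:
  assumes A: "pair_graph A" and K: "pair_graph K" and g: "g \<in> homs (hom_image r A) K"
  shows "pair_graph (hom_image r A)"
proof -
  interpret A: pair_graph A by fact
  interpret K: pair_graph K by fact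
  have "x \<noteq> y" if "(x, y) \<in> parcs (hom_image r A)" for x y
  proof -
    have "(g x, g y) \<in> parcs K" using g that by (auto simp: homs_def)
    then show ?thesis using K.no_loops' by auto
  qed
  moreover have "sym (parcs (hom_image r A))"
    using A.sym_arcs by (auto simp: sym_def symmetric_def A.arcs_symmetric)
  ultimately show ?thesis
    using A.in_arcsD1 A.in_arcsD2
    by unfold_locales (auto simp: symmetric_def)
qed

section \<open>Isomorphism from mutual embeddings or surjections\<close>

lemma bijective_surj_hom_imp_graph_iso:
  assumes G: "pair_graph G" and H: "pair_graph H"
    and f: "surj_hom f G H" "inj_on f (pverts G)"
  shows "graph_iso G H"
  unfolding graph_iso_iff[OF G H]
proof (intro exI[of _ f] conjI ballI)
  show "bij_betw f (pverts G) (pverts H)"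
    using f by (auto simp: bij_betw_def surj_hom_def)
  fix u v assume uv: "u \<in> pverts G" "v \<in> pverts G"
  show "(u, v) \<in> parcs G \<longleftrightarrow> (f u, f v) \<in> parcs H"
  proof
    assume "(f u, f v) \<in> parcs H"
    then have "(f u, f v) \<in> map_prod f f ` parcs G"
      using f(1) by (simp add: surj_hom_def)
    then obtain x y where xy: "(x, y) \<in> parcs G" "f x = f u" "f y = f v"
      by auto
    moreover have "x = u" "y = v"
      using inj_onD[OF f(2)] xy uv pair_graph_arcs_subset[OF G] by blast+
    ultimately show "(u, v) \<in> parcs G" by simp
  qed (use f(1) in \<open>auto simp: surj_hom_def homs_def\<close>)
qed

lemma inj_hom_card_le:
  assumes "pair_graph G" "pair_graph H" "inj_hom f G H"
  shows "card (pverts G) \<le> card (pverts H)" "card (parcs G) \<le> card (parcs H)"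
proof -
  have f: "inj_on f (pverts G)" "f ` pverts G \<subseteq> pverts H" "map_prod f f ` parcs G \<subseteq> parcs H"
    using assms(3) by (auto simp: inj_hom_def homs_def)
  have "inj_on (map_prod f f) (parcs G)"
    using map_prod_inj_on[OF f(1) f(1)] pair_graph_arcs_subset[OF assms(1)] by (rule inj_on_subset)
  then show "card (parcs G) \<le> card (parcs H)"
    using f(3) finite_parcs[OF assms(2)] by (rule card_inj_on_le)
  show "card (pverts G) \<le> card (pverts H)"
    using f(1,2) finite_pverts[OF assms(2)] by (rule card_inj_on_le)
qed

text \<open>
  By finiteness, the second embedding forces the first to hit all vertices and all arcs.
\<close>

lemma mutual_inj_homs_imp_graph_iso:
  assumes G: "pair_graph G" and H: "pair_graph H" and f: "inj_hom f G H" and g: "inj_hom g H G"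
  shows "graph_iso G H"
proof -
  have f': "inj_on f (pverts G)" "f ` pverts G \<subseteq> pverts H" "map_prod f f ` parcs G \<subseteq> parcs H"
    using f by (auto simp: inj_hom_def homs_def)
  have "inj_on (map_prod f f) (parcs G)"
    using map_prod_inj_on[OF f'(1) f'(1)] pair_graph_arcs_subset[OF G] by (rule inj_on_subset)
  then have "map_prod f f ` parcs G = parcs H"
    using inj_hom_card_le(2)[OF H G g] f'(3) finite_parcs[OF H]
    by (intro card_seteq) (auto simp: card_image)
  moreover have "f ` pverts G = pverts H"
    using inj_hom_card_le(1)[OF H G g] f'(1,2) finite_pverts[OF H]
    by (intro card_seteq) (auto simp: card_image)
  ultimately have "surj_hom f G H" using f by (auto simp: surj_hom_def inj_hom_def)
  then show ?thesis using G H f'(1) by (intro bijective_surj_hom_imp_graph_iso)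
qed

text \<open>
  Counting vertices suffices here, since surjectivity on arcs is part of a surjective
  homomorphism.
\<close>

lemma mutual_surj_homs_imp_graph_iso:
  assumes G: "pair_graph G" and H: "pair_graph H" and f: "surj_hom f G H" and g: "surj_hom g H G"
  shows "graph_iso G H"
proof -
  have V: "f ` pverts G = pverts H" "g ` pverts H = pverts G"
    using f g by (auto simp: surj_hom_def)
  have "card (pverts H) \<le> card (pverts G)" "card (pverts G) \<le> card (pverts H)"
    using V card_image_le finite_pverts G H by metis+
  then have "inj_on f (pverts G)"
    using V finite_pverts[OF G] by (intro eq_card_imp_inj_on) auto
  then show ?thesis using G H f by (intro bijective_surj_hom_imp_graph_iso)
qed

section \<open>Invariance of homomorphism counts under isomorphism\<close>

lemma graph_iso_obtains_inverse_homs: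
  assumes G: "pair_graph G" and H: "pair_graph H" and "graph_iso G H"
  obtains f g where "f \<in> homs G H" "g \<in> homs H G"
    "\<And>v. v \<in> pverts G \<Longrightarrow> g (f v) = v" "\<And>w. w \<in> pverts H \<Longrightarrow> f (g w) = w"
proof -
  obtain f where bij: "bij_betw f (pverts G) (pverts H)"
    and e: "\<And>u v. u \<in> pverts G \<Longrightarrow> v \<in> pverts G \<Longrightarrow> (u, v) \<in> parcs G \<longleftrightarrow> (f u, f v) \<in> parcs H"
    using assms(3) unfolding graph_iso_iff[OF G H] by blast
  define k where "k = inv_into (pverts G) f"
  have k: "k w \<in> pverts G" "f (k w) = w" if "w \<in> pverts H" for w
    using bij that unfolding k_def bij_betw_def by (auto intro: inv_into_into f_inv_into_f)
  have fV: "f v \<in> pverts H" and kf: "k (f v) = v" if "v \<in> pverts G" for v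
    using bij that unfolding k_def bij_betw_def by auto
  show thesis
  proof
    show "restrict f (pverts G) \<in> homs G H"
      using e fV pair_graph_arcs_subset[OF G] by (auto simp: homs_def)
    show "restrict k (pverts H) \<in> homs H G"
      using e k pair_graph_arcs_subset[OF H] by (auto simp: homs_def)
  qed (use fV k kf in auto)
qed

lemma hom_count_graph_iso_right:
  assumes A: "pair_graph A" and G: "pair_graph G" and H: "pair_graph H" and iso: "graph_iso G H"
  shows "hom_count A G = hom_count A H"
proof -
  obtain f g where f: "f \<in> homs G H" and g: "g \<in> homs H G"
    and gf: "\<And>v. v \<in> pverts G \<Longrightarrow> g (f v) = v" and fg: "\<And>w. w \<in> pverts H \<Longrightarrow> f (g w) = w"
    using graph_iso_obtains_inverse_homs[OF G H iso] by blast
  have "bij_betw (\<lambda>h. \<lambda>v\<in>pverts A. f (h v)) (homs A G) (homs A H)"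
    by (rule bij_betw_byWitness[where f' = "\<lambda>h. \<lambda>v\<in>pverts A. g (h v)"])
      (use homs_comp[OF A _ f] homs_comp[OF A _ g] gf fg in
        \<open>auto simp: homs_def PiE_iff extensional_def fun_eq_iff restrict_def\<close>)
  then show ?thesis unfolding hom_count_def by (rule bij_betw_same_card)
qed

lemma hom_count_graph_iso_left:
  assumes A: "pair_graph A" and G: "pair_graph G" and H: "pair_graph H" and iso: "graph_iso G H"
  shows "hom_count G A = hom_count H A"
proof -
  obtain f g where f: "f \<in> homs G H" and g: "g \<in> homs H G"
    and gf: "\<And>v. v \<in> pverts G \<Longrightarrow> g (f v) = v" and fg: "\<And>w. w \<in> pverts H \<Longrightarrow> f (g w) = w"
    using graph_iso_obtains_inverse_homs[OF G H iso] by blast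
  have V: "\<And>v. v \<in> pverts G \<Longrightarrow> f v \<in> pverts H" "\<And>w. w \<in> pverts H \<Longrightarrow> g w \<in> pverts G"
    using f g by (auto simp: homs_def)
  have "bij_betw (\<lambda>h. \<lambda>w\<in>pverts H. h (g w)) (homs G A) (homs H A)"
  proof (rule bij_betw_byWitness[where f' = "\<lambda>h. \<lambda>v\<in>pverts G. h (f v)"])
    show "\<forall>h\<in>homs G A. (\<lambda>v\<in>pverts G. (\<lambda>w\<in>pverts H. h (g w)) (f v)) = h"
      using V gf by (auto simp: homs_def PiE_iff extensional_def fun_eq_iff restrict_def)
    show "\<forall>h\<in>homs H A. (\<lambda>w\<in>pverts H. (\<lambda>v\<in>pverts G. h (f v)) (g w)) = h"
      using V fg by (auto simp: homs_def PiE_iff extensional_def fun_eq_iff restrict_def)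
  qed (use homs_comp[OF H g] homs_comp[OF G f] in blast)+
  then show ?thesis unfolding hom_count_def by (rule bij_betw_same_card)
qed

section \<open>Extension classes\<close>

lemma subset_Ext_class:
  assumes "\<forall>G\<in>\<F>. pair_graph G"
  shows "\<F> \<subseteq> Ext_class \<F>"
  using assms inj_hom_id surj_hom_id
  unfolding Ext_class_def Inj_class_def Sur_class_def by blast

text \<open>
  Surjective homomorphisms compose, so images of \<open>A\<close> are images of members of \<open>\<F>\<close>; injective ones
  compose, so graphs that embed into \<open>K\<close> embed into members of \<open>\<F>\<close>. In the left-hand
  induction \<open>r\<close> is a quotient map of the test graph and \<open>K\<close> is \<open>G\<close> or \<open>H\<close>; in the right-hand one
  \<open>A\<close> is \<open>G\<close> or \<open>H\<close>, \<open>K\<close> is the test graph and \<open>g\<close> is an inclusion.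
\<close>

lemma hom_image_in_Ext_class:
  assumes \<F>: "\<forall>G\<in>\<F>. pair_graph G" and A: "A \<in> Sur_class \<F>" and K: "K \<in> Inj_class \<F>"
    and g: "inj_hom g (hom_image r A) K"
  shows "hom_image r A \<in> Ext_class \<F>"
proof -
  have "pair_graph A" "pair_graph K" using A K by (auto simp: Sur_class_def Inj_class_def)
  then have Q: "pair_graph (hom_image r A)"
    using g by (auto simp: inj_hom_def intro: pair_graph_hom_image)
  obtain F h where "F \<in> \<F>" "surj_hom h F A" using A by (auto simp: Sur_class_def)
  then have "hom_image r A \<in> Sur_class \<F>"
    using Q \<F> surj_hom_to_hom_image[of F h A r] unfolding Sur_class_def by blast
  moreover obtain F' h' where "F' \<in> \<F>" "inj_hom h' K F'" using K by (auto simp: Inj_class_def)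
  then have "hom_image r A \<in> Inj_class \<F>"
    using Q inj_hom_comp[OF Q g, of h' F'] unfolding Inj_class_def by blast
  ultimately show ?thesis by (simp add: Ext_class_def)
qed

section \<open>Isolating one class of homomorphisms\<close>

text \<open>
  Kernels, or images, sort the homomorphisms into types. If the totals agree and
  all types but one are equally frequent on both sides, so is the remaining one.
\<close>

lemma card_fibre_eqI:
  assumes fin: "finite S" "finite T" and card: "card S = card T"
    and other: "\<And>k. k \<noteq> c \<Longrightarrow> card {s \<in> S. f s = k} = card {t \<in> T. g t = k}"
  shows "card {s \<in> S. f s = c} = card {t \<in> T. g t = c}"
proof -
  let ?K = "insert c (f ` S \<union> g ` T)"
  have K: "finite ?K" using fin by simp
  have "(\<Sum>k\<in>?K. card {s \<in> S. f s = k}) = card S"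
    using sum.group[OF fin(1) K, of f "\<lambda>_. 1 :: nat"] by auto
  moreover have "(\<Sum>k\<in>?K. card {t \<in> T. g t = k}) = card T"
    using sum.group[OF fin(2) K, of g "\<lambda>_. 1 :: nat"] by auto
  moreover have "(\<Sum>k\<in>?K - {c}. card {s \<in> S. f s = k}) = (\<Sum>k\<in>?K - {c}. card {t \<in> T. g t = k})"
    by (intro sum.cong) (auto intro: other)
  ultimately show ?thesis
    using card sum.remove[OF K, of c "\<lambda>k. card {s \<in> S. f s = k}"]
      sum.remove[OF K, of c "\<lambda>k. card {t \<in> T. g t = k}"] by simp
qed

section \<open>Left profiles determine the numbers of injective homomorphisms\<close>

text \<open>
  The kernel of \<open>f\<close> on \<open>V\<close>, encoded as the map that sends a point to a representative of its
  class. Encoded this way, the quotient of a graph by a kernel is a homomorphic image with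
  vertices in the original type.
\<close>

definition kernel_rep :: "'a set \<Rightarrow> ('a \<Rightarrow> 'b) \<Rightarrow> 'a \<Rightarrow> 'a" where
  "kernel_rep V f = (\<lambda>v\<in>V. SOME u. u \<in> V \<and> f u = f v)"

lemma kernel_rep_in: "v \<in> V \<Longrightarrow> kernel_rep V f v \<in> V"
  and kernel_rep_same: "v \<in> V \<Longrightarrow> f (kernel_rep V f v) = f v"
proof -
  assume v: "v \<in> V"
  then have "\<exists>u. u \<in> V \<and> f u = f v" by blast
  from someI_ex[OF this] v show "kernel_rep V f v \<in> V" "f (kernel_rep V f v) = f v"
    by (auto simp: kernel_rep_def)
qed

lemma kernel_rep_eq_iff:
  assumes "u \<in> V" "v \<in> V"
  shows "kernel_rep V f u = kernel_rep V f v \<longleftrightarrow> f u = f v"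
proof
  show "f u = f v" if "kernel_rep V f u = kernel_rep V f v"
    using kernel_rep_same[of u V f] kernel_rep_same[of v V f] that assms by simp
qed (use assms in \<open>simp add: kernel_rep_def\<close>)

lemma kernel_rep_cong:
  assumes "\<And>u v. u \<in> V \<Longrightarrow> v \<in> V \<Longrightarrow> f u = f v \<longleftrightarrow> g u = g v"
  shows "kernel_rep V f = kernel_rep V g"
  unfolding kernel_rep_def using assms by (intro restrict_ext arg_cong[where f = Eps]) auto

lemma kernel_rep_idem: "kernel_rep V (kernel_rep V f) = kernel_rep V f"
  by (rule kernel_rep_cong) (rule kernel_rep_eq_iff)

lemma kernel_rep_eq_id_iff_inj_on: "kernel_rep V f = (\<lambda>v\<in>V. v) \<longleftrightarrow> inj_on f V"
proof
  assume id: "kernel_rep V f = (\<lambda>v\<in>V. v)"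
  then show "inj_on f V" using kernel_rep_eq_iff[of _ V _ f] by (auto simp: inj_on_def)
next
  assume "inj_on f V"
  then have "kernel_rep V f v = v" if "v \<in> V" for v
    using that kernel_rep_in[of v V f] kernel_rep_same[of v V f] by (auto dest: inj_onD)
  then show "kernel_rep V f = (\<lambda>v\<in>V. v)" by (auto simp: kernel_rep_def fun_eq_iff)
qed

text \<open>
  The homomorphism theorem in counting form: a homomorphism factors uniquely through the
  quotient by its kernel, and the induced map on the quotient is injective.
\<close>

lemma card_homs_with_kernel:
  assumes A: "pair_graph A" and r: "kernel_rep (pverts A) r = r"
  shows "card {h \<in> homs A G. kernel_rep (pverts A) h = r} = card {g. inj_hom g (hom_image r A) G}"
proof -
  let ?V = "pverts A" and ?Q = "hom_image r A"
  have rV: "r v \<in> ?V" and rr: "r (r v) = r v" if "v \<in> ?V" for v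
    using kernel_rep_in[of v ?V r] kernel_rep_same[of v ?V r] that by (simp_all add: r)
  have hr: "h (r v) = h v" if "kernel_rep ?V h = r" "v \<in> ?V" for h v
    using kernel_rep_same[of v ?V h] that by simp
  have EA: "parcs A \<subseteq> ?V \<times> ?V" by (rule pair_graph_arcs_subset[OF A])
  have to: "inj_hom (restrict h (r ` ?V)) ?Q G" if h: "h \<in> homs A G" "kernel_rep ?V h = r" for h
  proof -
    have "inj_on h (r ` ?V)"
      using kernel_rep_eq_iff[of _ ?V _ h] h(2) hr[OF h(2)] by (auto simp: inj_on_def)
    moreover have "(restrict h (r ` ?V) (r u), restrict h (r ` ?V) (r v)) \<in> parcs G"
      if "(u, v) \<in> parcs A" for u v
    proof -
      have "u \<in> ?V" "v \<in> ?V" using that EA by auto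
      then show ?thesis using that h(1) hr[OF h(2)] by (simp add: homs_def)
    qed
    then have "restrict h (r ` ?V) \<in> homs ?Q G"
      using h(1) rV unfolding homs_def by (auto simp del: restrict_apply)
    ultimately show ?thesis by (auto simp: inj_hom_def inj_on_def)
  qed
  have from_hom: "(\<lambda>v\<in>?V. g (r v)) \<in> homs A G" if g: "inj_hom g ?Q G" for g
  proof -
    have "(g (r u), g (r v)) \<in> parcs G" "u \<in> ?V" "v \<in> ?V" if "(u, v) \<in> parcs A" for u v
      using g that EA imageI[OF that, of "map_prod r r"] by (auto simp: inj_hom_def homs_def)
    then show ?thesis using g by (auto simp: inj_hom_def homs_def)
  qed
  have from_ker: "kernel_rep ?V (\<lambda>v\<in>?V. g (r v)) = r" if g: "inj_hom g ?Q G" for g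
  proof -
    have "kernel_rep ?V (\<lambda>v\<in>?V. g (r v)) = kernel_rep ?V r"
      using g by (intro kernel_rep_cong) (auto simp: inj_hom_def inj_on_def)
    then show ?thesis by (simp add: r)
  qed
  have "bij_betw (\<lambda>h. restrict h (r ` ?V)) {h \<in> homs A G. kernel_rep ?V h = r} {g. inj_hom g ?Q G}"
  proof (rule bij_betw_byWitness[where f' = "\<lambda>g. \<lambda>v\<in>?V. g (r v)"])
    show "\<forall>h\<in>{h \<in> homs A G. kernel_rep ?V h = r}. (\<lambda>v\<in>?V. restrict h (r ` ?V) (r v)) = h"
      using hr by (auto simp: homs_def PiE_iff extensional_def fun_eq_iff)
    show "\<forall>g\<in>{g. inj_hom g ?Q G}. restrict (\<lambda>v\<in>?V. g (r v)) (r ` ?V) = g"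
      using rV rr by (auto simp: inj_hom_def homs_def PiE_iff extensional_def fun_eq_iff restrict_def)
  qed (use to from_hom from_ker in auto)
  then show ?thesis by (rule bij_betw_same_card)
qed

text \<open>
  Injective homomorphisms are those with trivial kernel. Every other kernel that
  occurs has a quotient that is a smaller member of the extension class, so by induction
  homomorphisms with that kernel are equally many into \<open>G\<close> and into \<open>H\<close>.
\<close>

lemma inj_hom_count_eq:
  assumes \<F>: "\<forall>G\<in>\<F>. pair_graph G" and GH: "G \<in> \<F>" "H \<in> \<F>"
    and eq: "\<And>A. A \<in> Ext_class \<F> \<Longrightarrow> hom_count A G = hom_count A H"
    and A: "A \<in> Ext_class \<F>"
  shows "card {g. inj_hom g A G} = card {g. inj_hom g A H}"
  using A
proof (induction "card (pverts A)" arbitrary: A rule: less_induct)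
  case less
  let ?V = "pverts A" and ?ker = "kernel_rep (pverts A)"
  have A: "pair_graph A" "A \<in> Sur_class \<F>"
    using less.prems by (auto simp: Ext_class_def Sur_class_def)
  have GH': "pair_graph G" "pair_graph H" "G \<in> Inj_class \<F>" "H \<in> Inj_class \<F>"
    using \<F> GH subset_Ext_class[OF \<F>] by (auto simp: Ext_class_def)
  have "card {h \<in> homs A G. ?ker h = r} = card {h \<in> homs A H. ?ker h = r}"
    if nontriv: "r \<noteq> (\<lambda>v\<in>?V. v)" for r
  proof (cases "?ker r = r")
    \<comment> \<open>Only maps fixed by \<open>?ker\<close> encode kernels, so for any other \<open>r\<close> both fibres are empty.\<close>
    case False
    then have "\<And>h :: 'a \<Rightarrow> 'a. ?ker h \<noteq> r" using kernel_rep_idem by metis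
    then show ?thesis by simp
  next
    case True
    let ?Q = "hom_image r A"
    \<comment> \<open>A quotient that embeds into neither graph, for instance one with a loop, contributes
       zero to both counts; only the others have to lie in the extension class.\<close>
    have "card {g. inj_hom g ?Q G} = card {g. inj_hom g ?Q H}"
    proof (cases "\<exists>g. inj_hom g ?Q G \<or> inj_hom g ?Q H")
      case True
      then have Q: "?Q \<in> Ext_class \<F>"
        using hom_image_in_Ext_class[OF \<F> A(2)] GH' by blast
      have "\<not> inj_on r ?V"
        using nontriv \<open>?ker r = r\<close> kernel_rep_eq_id_iff_inj_on[of ?V r] by simp
      then have "card (r ` ?V) < card ?V"
        using finite_pverts[OF A(1)] card_image_le eq_card_imp_inj_on order_le_imp_less_or_eq by blast
      then show ?thesis using less.hyps[of ?Q] Q by simp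
    qed simp
    then show ?thesis using card_homs_with_kernel[OF A(1) True] by metis
  qed
  then have "card {h \<in> homs A G. ?ker h = (\<lambda>v\<in>?V. v)} = card {h \<in> homs A H. ?ker h = (\<lambda>v\<in>?V. v)}"
    by (rule card_fibre_eqI[OF finite_homs[OF A(1) GH'(1)] finite_homs[OF A(1) GH'(2)]
          eq[OF less.prems, unfolded hom_count_def]])
  then show ?case by (simp add: kernel_rep_eq_id_iff_inj_on inj_hom_def)
qed

section \<open>Right profiles determine the numbers of surjective homomorphisms\<close>

lemma homs_with_image:
  assumes "pverts B \<subseteq> pverts A" "parcs B \<subseteq> parcs A"
  shows "{h \<in> homs G A. hom_image h G = B} = {h. surj_hom h G B}"
  using assms by (auto simp: surj_hom_iff_hom_image homs_def PiE_iff)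

lemma hom_image_subgraph:
  assumes "h \<in> homs G A"
  shows "pverts (hom_image h G) \<subseteq> pverts A" "parcs (hom_image h G) \<subseteq> parcs A"
  using assms by (auto simp: homs_def)

lemma inj_hom_subgraph:
  assumes "pverts B \<subseteq> pverts A" "parcs B \<subseteq> parcs A" "parcs B \<subseteq> pverts B \<times> pverts B"
  shows "inj_hom (\<lambda>v\<in>pverts B. v) B A"
  using assms by (auto simp: inj_hom_def homs_def inj_on_def)

text \<open>
  Dually, surjective homomorphisms are those whose image is the whole target, and every
  other image that occurs is a smaller member of the extension class.
\<close>

lemma surj_hom_count_eq:
  assumes \<F>: "\<forall>G\<in>\<F>. pair_graph G" and GH: "G \<in> \<F>" "H \<in> \<F>"
    and eq: "\<And>A. A \<in> Ext_class \<F> \<Longrightarrow> hom_count G A = hom_count H A"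
    and A: "A \<in> Ext_class \<F>"
  shows "card {h. surj_hom h G A} = card {h. surj_hom h H A}"
  using A
proof (induction "card (pverts A) + card (parcs A)" arbitrary: A rule: less_induct)
  case less
  have A: "pair_graph A" "A \<in> Inj_class \<F>"
    using less.prems by (auto simp: Ext_class_def Inj_class_def)
  have GH': "pair_graph G" "pair_graph H" "G \<in> Sur_class \<F>" "H \<in> Sur_class \<F>"
    using \<F> GH subset_Ext_class[OF \<F>] by (auto simp: Ext_class_def)
  have image_in_Ext: "hom_image h K \<in> Ext_class \<F>"
    if K: "pair_graph K" "K \<in> Sur_class \<F>" and h: "h \<in> homs K A" for K h
  proof -
    have "inj_hom (\<lambda>v\<in>pverts (hom_image h K). v) (hom_image h K) A"
      using pair_graph_arcs_subset[OF K(1)] by (intro inj_hom_subgraph hom_image_subgraph[OF h]) auto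
    then show ?thesis using hom_image_in_Ext_class[OF \<F> K(2) A(2)] by blast
  qed
  have "card {h \<in> homs G A. hom_image h G = B} = card {h \<in> homs H A. hom_image h H = B}"
    if proper: "B \<noteq> A" for B
  proof (cases "(\<exists>h\<in>homs G A. hom_image h G = B) \<or> (\<exists>h\<in>homs H A. hom_image h H = B)")
    case True
    then have B: "B \<in> Ext_class \<F>" and sub: "pverts B \<subseteq> pverts A" "parcs B \<subseteq> parcs A"
      using image_in_Ext GH' hom_image_subgraph by blast+
    have "pverts B \<subset> pverts A \<or> parcs B \<subset> parcs A"
      using proper sub by (auto intro: pair_pre_digraph.equality)
    then have "card (pverts B) + card (parcs B) < card (pverts A) + card (parcs A)"
      using finite_pverts[OF A(1)] finite_parcs[OF A(1)] sub
      by (metis add_less_le_mono add_le_less_mono card_mono psubset_card_mono)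
    then have "card {h. surj_hom h G B} = card {h. surj_hom h H B}"
      using B by (rule less.hyps)
    then show ?thesis by (simp only: homs_with_image[OF sub])
  next
    case False
    then have "{h \<in> homs G A. hom_image h G = B} = {}" "{h \<in> homs H A. hom_image h H = B} = {}"
      by auto
    then show ?thesis by (simp only:)
  qed
  then have "card {h \<in> homs G A. hom_image h G = A} = card {h \<in> homs H A. hom_image h H = A}"
    by (rule card_fibre_eqI[OF finite_homs[OF GH'(1) A(1)] finite_homs[OF GH'(2) A(1)]
          eq[OF less.prems, unfolded hom_count_def]])
  then show ?case by (simp add: surj_hom_iff_hom_image)
qed

section \<open>Profiles and isomorphism\<close>

lemma finite_inj_homs:
  assumes "pair_graph G" "pair_graph H"
  shows "finite {h. inj_hom h G H}"
  by (rule finite_subset[OF _ finite_homs[OF assms]]) (auto simp: inj_hom_def)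

lemma finite_surj_homs:
  assumes "pair_graph G" "pair_graph H"
  shows "finite {h. surj_hom h G H}"
  by (rule finite_subset[OF _ finite_homs[OF assms]]) (auto simp: surj_hom_def)

lemma left_profile_eq_iff:
  "left_profile \<A> G = left_profile \<A> H \<longleftrightarrow> (\<forall>A\<in>\<A>. hom_count A G = hom_count A H)"
  by (auto simp: left_profile_def fun_eq_iff restrict_def)

lemma right_profile_eq_iff:
  "right_profile G \<A> = right_profile H \<A> \<longleftrightarrow> (\<forall>A\<in>\<A>. hom_count G A = hom_count H A)"
  by (auto simp: right_profile_def fun_eq_iff restrict_def)

lemma pair_graph_if_in_Ext_class: "A \<in> Ext_class \<F> \<Longrightarrow> pair_graph A"
  by (auto simp: Ext_class_def Sur_class_def)

lemma graph_iso_iff_left_profile_eq: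
  assumes \<F>: "\<forall>G\<in>\<F>. pair_graph G" and GH: "G \<in> \<F>" "H \<in> \<F>"
  shows "graph_iso G H \<longleftrightarrow> left_profile (Ext_class \<F>) G = left_profile (Ext_class \<F>) H"
  unfolding left_profile_eq_iff
proof
  show "\<forall>A\<in>Ext_class \<F>. hom_count A G = hom_count A H" if "graph_iso G H"
    using that \<F> GH hom_count_graph_iso_right pair_graph_if_in_Ext_class by blast
next
  assume "\<forall>A\<in>Ext_class \<F>. hom_count A G = hom_count A H"
  then have eq: "card {g. inj_hom g A G} = card {g. inj_hom g A H}" if "A \<in> \<F>" for A
    using inj_hom_count_eq[OF \<F> GH] that subset_Ext_class[OF \<F>] by blast
  have pg: "pair_graph G" "pair_graph H" using \<F> GH by auto
  have "card {g. inj_hom g G G} \<noteq> 0" "card {g. inj_hom g H H} \<noteq> 0"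
    using pg inj_hom_id finite_inj_homs by (auto simp: card_eq_0_iff)
  then have "{g. inj_hom g G H} \<noteq> {}" "{g. inj_hom g H G} \<noteq> {}"
    using eq[OF GH(1)] eq[OF GH(2)] by (metis card.empty)+
  then show "graph_iso G H" using mutual_inj_homs_imp_graph_iso[OF pg] by blast
qed

lemma graph_iso_iff_right_profile_eq:
  assumes \<F>: "\<forall>G\<in>\<F>. pair_graph G" and GH: "G \<in> \<F>" "H \<in> \<F>"
  shows "graph_iso G H \<longleftrightarrow> right_profile G (Ext_class \<F>) = right_profile H (Ext_class \<F>)"
  unfolding right_profile_eq_iff
proof
  show "\<forall>A\<in>Ext_class \<F>. hom_count G A = hom_count H A" if "graph_iso G H"
    using that \<F> GH hom_count_graph_iso_left pair_graph_if_in_Ext_class by blast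
next
  assume "\<forall>A\<in>Ext_class \<F>. hom_count G A = hom_count H A"
  then have eq: "card {h. surj_hom h G A} = card {h. surj_hom h H A}" if "A \<in> \<F>" for A
    using surj_hom_count_eq[OF \<F> GH] that subset_Ext_class[OF \<F>] by blast
  have pg: "pair_graph G" "pair_graph H" using \<F> GH by auto
  have "card {h. surj_hom h G G} \<noteq> 0" "card {h. surj_hom h H H} \<noteq> 0"
    using pg surj_hom_id finite_surj_homs by (auto simp: card_eq_0_iff)
  then have "{h. surj_hom h G H} \<noteq> {}" "{h. surj_hom h H G} \<noteq> {}"
    using eq[OF GH(1)] eq[OF GH(2)] by (metis card.empty)+
  then show "graph_iso G H" using mutual_surj_homs_imp_graph_iso[OF pg] by blast
qed

theorem theorem3:
  fixes \<F> :: "'a pair_pre_digraph set"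
  assumes "graph_class \<F>"
  shows "(\<forall>G\<in>\<F>. \<forall>H\<in>\<F>.
            (graph_iso G H \<longleftrightarrow> left_profile (Ext_class \<F>) G = left_profile (Ext_class \<F>) H) \<and>
            (graph_iso G H \<longleftrightarrow> right_profile G (Ext_class \<F>) = right_profile H (Ext_class \<F>)))
       \<and> (Ext_class \<F> = \<F> \<longrightarrow>
            (\<forall>G\<in>\<F>. \<forall>H\<in>\<F>.
              (graph_iso G H \<longleftrightarrow> left_profile \<F> G = left_profile \<F> H) \<and>
              (graph_iso G H \<longleftrightarrow> right_profile G \<F> = right_profile H \<F>)))"
proof -
  have \<F>: "\<forall>G\<in>\<F>. pair_graph G" using assms by (simp add: graph_class_def)
  show ?thesis
    using graph_iso_iff_left_profile_eq[OF \<F>] graph_iso_iff_right_profile_eq[OF \<F>] by auto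
qed

end
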